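(* Let $G=(V,E)$ be a finite graph with boundary $B\neq\emptyset$ and non-empty connected interior. Let $c,p,\ell\ge 1$ be integers and let $\mathcal{P}$ be a finite collection of interior-boundary paths in $G$. Suppose $\mathcal{P}$ is a $c$-covering on vertices and a $p$-packing on edges, with each path $P\in\mathcal{P}$ of length at most $\ell$. Then $$\lambda_1(G,B)\ \geq\ \frac{4c}{p}\sin^2\frac{\pi}{4\ell+2}\ \geq\ \frac{c}{p\,\ell^2}.$$
   Context: Graphs are finite, undirected and simple. A graph with boundary is a pair $(G,B)$ where $G=(V,E)$ is a graph and $B\subset V$ is such that, with $\Omega:=V\setminus B$ (the interior), (i) $B$ is exactly the set of vertices outside $\Omega$ having at least one neighbor in $\Omega$, and (ii) no edge of $G$ joins two vertices of $B$. It is assumed throughout that $B$ and $\Omega$ are non-empty and that the subgraph induced on $\Omega$ is connected. The first Dirichlet eigenvalue $\lambda_1(G,B)$ is the smallest $\lambda$ for which there is a nonzero $f:V\to\mathbb{R}$ with $f=0$ on $B$ and $\sum_{y\sim x}(f(x)-f(y))=\lambda f(x)$ for all $x\in\Omega$. Equivalently, $\lambda_1(G,B)=\min \frac{\sum_{\{x,y\}\in E}(f(x)-f(y))^2}{\sum_{x\in\Omega}f(x)^2}$ over nonzero $f:V\to\mathbb{R}$ vanishing on $B$. An interior-boundary path is a path $P=(V_P,E_P)$ in $G$ (without repeated vertices) connecting an interior vertex and a boundary vertex; its length is $|E_P|$. A collection $\mathcal{P}$ of paths is a $c$-covering on vertices if each interior vertex $v\in\Omega$ belongs to $V_P$ for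 at least $c$ of the paths $P\in\mathcal{P}$ (counted with multiplicity). It is a $p$-packing on edges if each edge $e\in E$ belongs to $E_P$ for at most $p$ of the paths $P\in\mathcal{P}$ (counted with multiplicity). *)

theory Defs
  imports
    Complex_Main
    "HOL-Library.Multiset"
    "Graph_Theory.Digraph_Component"
    "Graph_Theory.Vertex_Walk"
begin

text \<open>
  A finite simple undirected graph is a \<^locale>\<open>pair_graph\<close>: a finite loop-free digraph whose arcs
  form a symmetric set of ordered pairs. An undirected edge \<open>{u, v}\<close> corresponds to the two arcs
  \<open>(u, v)\<close> and \<open>(v, u)\<close>.
\<close>

definition undirected :: "('a \<times> 'a) set \<Rightarrow> 'a set set" where
  "undirected A = (\<lambda>(u, v). {u, v}) ` A"

definition edges :: "'a pair_pre_digraph \<Rightarrow> 'a set set" where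
  "edges G = undirected (parcs G)"

definition interior_verts :: "'a pair_pre_digraph \<Rightarrow> 'a set \<Rightarrow> 'a set" where
  "interior_verts G B = pverts G - B"

locale graph_with_boundary = pair_graph G
  for G :: "'a pair_pre_digraph" +
  fixes B :: "'a set"
  assumes boundary_subset: "B \<subseteq> pverts G"
    and boundary_eq: "B = {v \<in> pverts G - interior_verts G B. \<exists>w \<in> interior_verts G B. (v, w) \<in> parcs G}"
    and no_boundary_edge: "\<not> (\<exists>u \<in> B. \<exists>v \<in> B. (u, v) \<in> parcs G)"
    and boundary_nonempty: "B \<noteq> {}"
    and interior_nonempty: "interior_verts G B \<noteq> {}"
    and interior_connected:
      "Digraph_Component.connected (with_proj G \<restriction> interior_verts G B)"

definition graph_laplacian :: "'a pair_pre_digraph \<Rightarrow> ('a \<Rightarrow> real) \<Rightarrow> 'a \<Rightarrow> real" where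
  "graph_laplacian G f x = (\<Sum>y | (x, y) \<in> parcs G. f x - f y)"

text \<open>
  Functions on the vertex set are total functions on the vertex type, so being nonzero has to be
  witnessed at a vertex of the graph.
\<close>

definition dirichlet_eigenvalue :: "'a pair_pre_digraph \<Rightarrow> 'a set \<Rightarrow> real \<Rightarrow> bool" where
  "dirichlet_eigenvalue G B \<mu> \<longleftrightarrow>
     (\<exists>f. (\<exists>x \<in> pverts G. f x \<noteq> 0) \<and> (\<forall>x \<in> B. f x = 0) \<and>
          (\<forall>x \<in> interior_verts G B. graph_laplacian G f x = \<mu> * f x))"

definition first_dirichlet_eigenvalue :: "'a pair_pre_digraph \<Rightarrow> 'a set \<Rightarrow> real" where
  "first_dirichlet_eigenvalue G B = (LEAST \<mu>. dirichlet_eigenvalue G B \<mu>)"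

text \<open>
  A path is given by its list of distinct vertices. An undirected path between an interior and a
  boundary vertex is listed from its interior end to its boundary end, which represents it
  uniquely. Its inner vertices may lie in the boundary.
\<close>

definition interior_boundary_path :: "'a pair_pre_digraph \<Rightarrow> 'a set \<Rightarrow> 'a vwalk \<Rightarrow> bool" where
  "interior_boundary_path G B P \<longleftrightarrow>
     vpath P (with_proj G) \<and> hd P \<in> interior_verts G B \<and> last P \<in> B"

definition path_edges :: "'a vwalk \<Rightarrow> 'a set set" where
  "path_edges P = undirected (set (vwalk_arcs P))"

definition covering_on_vertices ::
    "'a pair_pre_digraph \<Rightarrow> 'a set \<Rightarrow> nat \<Rightarrow> 'a vwalk multiset \<Rightarrow> bool" where
  "covering_on_vertices G B c \<P> \<longleftrightarrow>
     (\<forall>v \<in> interior_verts G B. c \<le> size {#P \<in># \<P>. v \<in> set P#})"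

definition packing_on_edges :: "'a pair_pre_digraph \<Rightarrow> nat \<Rightarrow> 'a vwalk multiset \<Rightarrow> bool" where
  "packing_on_edges G p \<P> \<longleftrightarrow> (\<forall>e \<in> edges G. size {#P \<in># \<P>. e \<in> path_edges P#} \<le> p)"

end

theory Submission
  imports
    Defs
    "HOL-Analysis.Function_Topology"
    "HOL-Analysis.Convex"
begin

text \<open>
  Along a path of length at most \<open>l\<close> with \<open>f = 0\<close> at its boundary end, the edge energy of \<open>f\<close>
  dominates \<open>4 sin\<^sup>2(\<theta>/2)\<close> times the sum of the \<open>f\<^sup>2\<close>, where \<open>\<theta> = \<pi> / (2l + 1)\<close>: the positive sequence
  \<open>sin (i\<theta>)\<close> is the ground state of the path of length \<open>l\<close> with one Dirichlet and one Neumann end, and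
  one completes squares against it. Summing over all paths and counting each vertex at least \<open>c\<close>
  and each edge at most \<open>p\<close> times bounds the Rayleigh quotient of every \<open>f\<close> vanishing on the boundary.
  That the set of Dirichlet eigenvalues has a least element follows by minimising the Rayleigh quotient
  over the compact unit sphere.
\<close>

section \<open>Double counting and elementary inequalities\<close>

text \<open>Exchanges the sum over paths with a sum over vertices or arcs, so that covering and
  packing multiplicities appear as coefficients.\<close>

lemma sum_mset_sum_double_count:
  fixes w :: "'b \<Rightarrow> real"
  assumes "finite A"
  shows "(\<Sum>P\<in>#M. \<Sum>a\<in>{a \<in> A. R P a}. w a) = (\<Sum>a\<in>A. real (size {#P \<in># M. R P a#}) * w a)"
proof (induction M)
  case empty
  show ?case by simp
next
  case (add P M)
  have "(\<Sum>a\<in>A. real (size {#P' \<in># add_mset P M. R P' a#}) * w a) =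
      (\<Sum>a\<in>A. real (size {#P \<in># M. R P a#}) * w a + (if R P a then w a else 0))"
    by (intro sum.cong) (auto simp: algebra_simps)
  then show ?case
    using add assms by (simp add: sum.distrib sum.inter_filter)
qed

text \<open>Near 0 the linear term dominates. This turns minimality under the perturbations
  \<open>f + t * d\<close> into the eigenvalue equation.\<close>

lemma linear_coeff_zero_if_quadratic_nonneg:
  fixes a b :: real
  assumes "\<And>t. 0 \<le> a * t + b * t\<^sup>2"
  shows "a = 0"
proof (rule ccontr)
  assume "a \<noteq> 0"
  \<comment> \<open>Small enough for the linear term to win at \<open>t = - a * s\<close>, where the
    quadratic factors as below.\<close>
  define s where "s = 1 / (\<bar>b\<bar> + 1)"
  have s: "s > 0" "b * s < 1"
    unfolding s_def by (auto simp: field_simps)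
  have "a * (- a * s) + b * (- a * s)\<^sup>2 = a\<^sup>2 * s * (b * s - 1)"
    by (simp add: power2_eq_square algebra_simps)
  also have "\<dots> < 0"
    using s \<open>a \<noteq> 0\<close> by (intro mult_pos_neg) auto
  finally show False
    using assms[of "- a * s"] by simp
qed

text \<open>Yields the second inequality of the theorem after squaring. The concave sine lies above
  its chord, here of slope \<open>3 / pi\<close>.\<close>

lemma one_le_two_mult_sin:
  fixes l :: nat
  assumes "l \<ge> 1"
  shows "1 \<le> 2 * real l * sin (pi / (4 * real l + 2))"
proof -
  define x where "x = pi / (4 * real l + 2)"
  \<comment> \<open>Equality holds at \<open>l = 1\<close>, so the chord has to end at \<open>\<pi>/6\<close>; Jordan's chord to \<open>\<pi>/2\<close> is too weak.\<close>
  have "concave_on {0..pi/6} sin"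
    by (rule f''_le0_imp_concave[where f' = cos and f'' = "\<lambda>x. - sin x"])
      (auto intro!: derivative_eq_intros sin_ge_zero)
  moreover have "x \<in> {0..pi/6}"
    using assms by (auto simp: x_def field_simps)
  ultimately have "sin x \<ge> (sin (pi/6) - sin 0) / (pi/6 - 0) * (x - 0) + sin 0"
    by (rule concave_onD_Icc')
  then have "sin x \<ge> 3 * x / pi"
    by (simp add: sin_30 field_simps)
  also have "3 * x / pi = 3 / (4 * real l + 2)"
    by (simp add: x_def)
  finally have "2 * real l * sin x \<ge> 2 * real l * (3 / (4 * real l + 2))"
    by (intro mult_left_mono) auto
  moreover have "2 * real l * (3 / (4 * real l + 2)) \<ge> 1"
    using assms by (simp add: field_simps)
  ultimately show ?thesis unfolding x_def by linarith
qed

section \<open>Energy estimate along a single path\<close>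

text \<open>Completing the square on one edge, with \<open>a\<close> and \<open>b\<close> the ground
  state values at the ends carrying \<open>y\<close> and \<open>x\<close>. For \<open>b = 0\<close>
  both sides equal \<open>y\<^sup>2\<close>, since \<open>x = 0\<close> removes the term with
  \<open>a / b\<close>.\<close>

lemma weighted_square_diff_ge:
  fixes a b x y :: real
  assumes "a > 0" "b \<ge> 0" "b = 0 \<longrightarrow> x = 0"
  shows "(y - x)\<^sup>2 \<ge> (1 - b / a) * y\<^sup>2 - (a / b - 1) * x\<^sup>2"
proof (cases "b = 0")
  case True
  then show ?thesis using assms by simp
next
  case False
  then have b: "b > 0" using assms by simp
  have "(y - x)\<^sup>2 - ((1 - b / a) * y\<^sup>2 - (a / b - 1) * x\<^sup>2) = (b * y - a * x)\<^sup>2 / (a * b)"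
    using assms(1) b by (simp add: field_simps power2_eq_square)
  also have "\<dots> \<ge> 0" using assms(1) b by simp
  finally show ?thesis by simp
qed

text \<open>Vertices are weighted by \<open>sin (n\<theta>)\<close>, with \<open>n\<close> counted from the boundary end. The induction
  carries a correction term at the head, which is zero for a one-vertex path because
  \<open>f (hd P) = 0\<close> there, whatever the value of the quotient by \<open>sin 0\<close>.\<close>

lemma vwalk_energy_ge:
  fixes f :: "'a \<Rightarrow> real" and \<theta> :: real
  assumes "P \<noteq> []" "f (last P) = 0"
    and "\<And>n. 1 \<le> n \<Longrightarrow> n < length P \<Longrightarrow> sin (real n * \<theta>) > 0"
  shows "(\<Sum>(u, v)\<leftarrow>vwalk_arcs P. (f u - f v)\<^sup>2) \<ge> (2 - 2 * cos \<theta>) * (\<Sum>v\<leftarrow>P. (f v)\<^sup>2) +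
    (sin (real (length P) * \<theta>) / sin (real (length P - 1) * \<theta>) - 1) * (f (hd P))\<^sup>2"
  using assms
proof (induction P rule: vwalk_arcs.induct)
  case 1
  then show ?case by simp
next
  case (2 v)
  then show ?case by simp
next
  case (3 u v xs)
  define n where "n = length (v # xs)"
  define h where "h k = sin (real k * \<theta>)" for k
  have n: "n \<ge> 1" by (simp add: n_def)
  have hn: "h n > 0" using "3.prems"(3)[of n] by (simp add: h_def n_def)
  have hn1: "h (n - 1) \<ge> 0"
    using "3.prems"(3)[of "n - 1"] by (cases xs) (auto simp: h_def n_def less_imp_le)
  \<comment> \<open>\<open>h (n - 1)\<close> vanishes only for \<open>n = 1\<close>, when
    \<open>v\<close> is the boundary end.\<close>
  have zero: "h (n - 1) = 0 \<longrightarrow> f v = 0"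
    using "3.prems"(2) "3.prems"(3)[of "n - 1"] by (cases xs) (auto simp: h_def n_def)
  have IH: "(\<Sum>(u, v)\<leftarrow>vwalk_arcs (v # xs). (f u - f v)\<^sup>2) \<ge>
      (2 - 2 * cos \<theta>) * (\<Sum>v\<leftarrow>v # xs. (f v)\<^sup>2) + (h n / h (n - 1) - 1) * (f v)\<^sup>2"
    using "3.IH" "3.prems" unfolding h_def n_def by simp
  \<comment> \<open>Three-term recurrence: away from the ends, \<open>h\<close> is an eigenvector of
    the path Laplacian for \<open>2 - 2 * cos \<theta>\<close>.\<close>
  have "h (Suc n) + h (n - 1) = 2 * cos \<theta> * h n"
  proof -
    have "real (n - 1) * \<theta> = real n * \<theta> - \<theta>" "real (Suc n) * \<theta> = real n * \<theta> + \<theta>"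
      using n by (auto simp: of_nat_diff algebra_simps)
    then show ?thesis unfolding h_def by (simp add: sin_add sin_diff)
  qed
  then have ratio: "h (Suc n) / h n = 2 * cos \<theta> - h (n - 1) / h n"
    using hn by (simp add: field_simps)
  \<comment> \<open>The new vertex term and the new correction add up to the \<open>u\<close>-part
    of the completed square; its \<open>v\<close>-part cancels the old correction in
    \<open>IH\<close>.\<close>
  have "(2 - 2 * cos \<theta>) * (f u)\<^sup>2 + (h (Suc n) / h n - 1) * (f u)\<^sup>2 =
      (1 - h (n - 1) / h n) * (f u)\<^sup>2"
    unfolding ratio by (simp add: algebra_simps)
  moreover have "(f u - f v)\<^sup>2 \<ge> (1 - h (n - 1) / h n) * (f u)\<^sup>2 - (h n / h (n - 1) - 1) * (f v)\<^sup>2"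
    using hn hn1 zero by (rule weighted_square_diff_ge)
  ultimately have "(\<Sum>(u, v)\<leftarrow>vwalk_arcs (u # v # xs). (f u - f v)\<^sup>2) \<ge>
      (2 - 2 * cos \<theta>) * (\<Sum>v\<leftarrow>u # v # xs. (f v)\<^sup>2) + (h (Suc n) / h n - 1) * (f u)\<^sup>2"
    using IH by (simp add: distrib_left)
  then show ?case by (simp add: n_def h_def)
qed

text \<open>With \<open>\<theta> = pi / (2 * l + 1)\<close> the sine takes equal values at
  \<open>l * \<theta>\<close> and \<open>(l + 1) * \<theta>\<close>, which is the Neumann condition
  at the interior end. The correction at the head thus vanishes for length \<open>l\<close> and is
  nonnegative for shorter paths.\<close>

lemma vwalk_energy_ge_sin:
  fixes f :: "'a \<Rightarrow> real"
  assumes "P \<noteq> []" "f (last P) = 0" "vwalk_length P \<le> l"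
  shows "(\<Sum>(u, v)\<leftarrow>vwalk_arcs P. (f u - f v)\<^sup>2) \<ge>
    4 * (sin (pi / (4 * real l + 2)))\<^sup>2 * (\<Sum>v\<leftarrow>P. (f v)\<^sup>2)"
proof -
  define \<theta> where "\<theta> = pi / (2 * real l + 1)"
  define m where "m = length P - 1"
  have m: "m \<le> l" "length P = Suc m" using assms by (auto simp: m_def)
  have "real n * \<theta> < pi" if "n \<le> l" for n
  proof -
    have "real n * pi < (2 * real l + 1) * pi"
      using that by (intro mult_strict_right_mono) auto
    then show ?thesis by (simp add: \<theta>_def field_simps)
  qed
  then have pos: "sin (real n * \<theta>) > 0" if "1 \<le> n" "n \<le> l" for n
    using that by (intro sin_gt_zero) (auto simp: \<theta>_def)
  have half: "\<theta> / 2 = pi / (4 * real l + 2)" by (simp add: \<theta>_def field_simps)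
  have "2 - 2 * cos \<theta> = 4 * (sin (\<theta> / 2))\<^sup>2"
    using cos_double_sin[of "\<theta> / 2"] by simp
  then have eig: "2 - 2 * cos \<theta> = 4 * (sin (pi / (4 * real l + 2)))\<^sup>2" by (simp add: half)
  have "sin (real (Suc m) * \<theta>) / sin (real m * \<theta>) - 1 \<ge> 0" if "m \<noteq> 0"
  proof -
    have "real (Suc m) * \<theta> - real m * \<theta> = \<theta>" "real (Suc m) * \<theta> + real m * \<theta> = (2 * real m + 1) * \<theta>"
      by (auto simp: algebra_simps)
    then have "sin (real (Suc m) * \<theta>) - sin (real m * \<theta>) =
        2 * sin (\<theta> / 2) * cos ((2 * real m + 1) * \<theta> / 2)"
      by (simp add: sin_diff_sin)
    also have "\<dots> \<ge> 0"
    proof (intro mult_nonneg_nonneg sin_ge_zero cos_ge_zero)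
      have "(2 * real m + 1) * pi \<le> (2 * real l + 1) * pi"
        using m by (intro mult_right_mono) auto
      then show "(2 * real m + 1) * \<theta> / 2 \<le> pi / 2"
        by (simp add: \<theta>_def divide_simps)
      have "0 \<le> (2 * real m + 1) * \<theta> / 2" by (simp add: \<theta>_def)
      then show "- (pi / 2) \<le> (2 * real m + 1) * \<theta> / 2"
        using pi_ge_zero by linarith
      show "\<theta> / 2 \<le> pi"
        unfolding half by (simp add: field_simps)
    qed (auto simp: \<theta>_def)
    finally show ?thesis
      using pos[of m] that m by (simp add: field_simps)
  qed
  moreover have "f (hd P) = 0" if "m = 0"
    using that m assms(1,2) by (cases P) auto
  ultimately have "(sin (real (Suc m) * \<theta>) / sin (real m * \<theta>) - 1) * (f (hd P))\<^sup>2 \<ge> 0"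
    by (cases "m = 0") auto
  then show ?thesis
    using vwalk_energy_ge[of P f \<theta>] assms(1,2) pos m eig by force
qed

section \<open>Edge energy and Green's formula\<close>

text \<open>Every undirected edge contributes twice, once for each of its arcs.\<close>

definition arc_energy :: "('a \<times> 'a) set \<Rightarrow> ('a \<Rightarrow> real) \<Rightarrow> ('a \<Rightarrow> real) \<Rightarrow> real" where
  "arc_energy A f g = (\<Sum>(u, v)\<in>A. (f u - f v) * (g u - g v))"

lemma arc_energy_perturb:
  "arc_energy A (\<lambda>x. f x + t * g x) (\<lambda>x. f x + t * g x) =
    arc_energy A f f + 2 * t * arc_energy A f g + t\<^sup>2 * arc_energy A g g"
  unfolding arc_energy_def sum_distrib_left sum.distrib[symmetric]
  by (intro sum.cong) (auto simp: power2_eq_square algebra_simps)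

lemma arc_energy_scale:
  "arc_energy A (\<lambda>x. t * f x) (\<lambda>x. t * f x) = t\<^sup>2 * arc_energy A f f"
  unfolding arc_energy_def sum_distrib_left
  by (intro sum.cong) (auto simp: power2_eq_square algebra_simps)

text \<open>Summation by parts: reversing all arcs shows that the \<open>g u\<close> and
  \<open>g v\<close> parts of the energy have the same sum, whence the factor 2.\<close>

lemma (in pair_pseudo_graph) arc_energy_green:
  "arc_energy (parcs G) f g = 2 * (\<Sum>x\<in>pverts G. g x * graph_laplacian G f x)"
proof -
  have A: "parcs G = Sigma (pverts G) (\<lambda>x. {y. (x, y) \<in> parcs G})"
    by (auto dest: in_arcsD1)
  have fin: "finite {y. (x, y) \<in> parcs G}" for x
    by (rule finite_subset[OF _ pair_finite_verts]) (auto dest: in_arcsD2)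
  have 1: "(\<Sum>x\<in>pverts G. g x * graph_laplacian G f x) = (\<Sum>(u, v)\<in>parcs G. g u * (f u - f v))"
    unfolding graph_laplacian_def sum_distrib_left
    by (simp add: sum.Sigma fin pair_finite_verts A[symmetric])
  have "prod.swap ` parcs G = parcs G"
    using pair_sym_arcs by (auto simp: symmetric_def dest: symD intro: rev_image_eqI)
  then have 2: "(\<Sum>(u, v)\<in>parcs G. g u * (f u - f v)) = (\<Sum>(u, v)\<in>parcs G. g v * (f v - f u))"
    using sum.reindex[of prod.swap "parcs G" "\<lambda>(u, v). g u * (f u - f v)"]
    by (simp add: case_prod_unfold)
  have "arc_energy (parcs G) f g =
      (\<Sum>(u, v)\<in>parcs G. g u * (f u - f v)) + (\<Sum>(u, v)\<in>parcs G. g v * (f v - f u))"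
    unfolding arc_energy_def sum.distrib[symmetric] by (intro sum.cong) (auto simp: algebra_simps)
  then show ?thesis using 1 2 by simp
qed

section \<open>Arcs of a path and their reversals\<close>

lemma set_vwalk_arcs_subset: "set (vwalk_arcs P) \<subseteq> set P \<times> set P"
  by (induction P rule: vwalk_arcs.induct) auto

text \<open>The tail of the first arc never recurs, so no later arc can reverse it. Forward and
  reversed arcs of a path are therefore disjoint.\<close>

lemma vwalk_arcs_asym:
  "distinct P \<Longrightarrow> (u, v) \<in> set (vwalk_arcs P) \<Longrightarrow> (v, u) \<notin> set (vwalk_arcs P)"
proof (induction P rule: vwalk_arcs.induct)
  case (3 x y xs)
  then show ?case using set_vwalk_arcs_subset[of "y # xs"] by auto
qed auto

lemma distinct_vwalk_arcs: "distinct P \<Longrightarrow> distinct (vwalk_arcs P)"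
proof (induction P rule: vwalk_arcs.induct)
  case (3 x y xs)
  then show ?case using set_vwalk_arcs_subset[of "y # xs"] by auto
qed auto

text \<open>The path is traversed in one direction only, while the right-hand sum sees both arcs of
  each of its edges; this accounts for the factor 2.\<close>

lemma (in pair_pseudo_graph) vpath_energy_le:
  assumes "vpath P (with_proj G)"
  shows "2 * (\<Sum>(u, v)\<leftarrow>vwalk_arcs P. (f u - f v)\<^sup>2) \<le>
    (\<Sum>(u, v)\<in>{(u, v) \<in> parcs G. {u, v} \<in> path_edges P}. (f u - f v)\<^sup>2 :: real)"
proof -
  define S where "S = set (vwalk_arcs P)"
  have P: "distinct P" "S \<subseteq> parcs G" using assms by (auto simp: vpath_def vwalk_def S_def)
  let ?w = "\<lambda>(u, v). (f u - f v)\<^sup>2 :: real"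
  have fin: "finite S" by (simp add: S_def)
  have "(\<Sum>a\<leftarrow>vwalk_arcs P. ?w a) = sum ?w S"
    using P distinct_vwalk_arcs unfolding S_def by (metis sum_list_distinct_conv_sum_set)
  moreover have "sum ?w (prod.swap ` S) = sum ?w S"
    by (subst sum.reindex) (auto intro!: sum.cong simp: power2_commute)
  moreover have "S \<inter> prod.swap ` S = {}"
    using vwalk_arcs_asym[OF P(1)] unfolding S_def by auto
  ultimately have "2 * (\<Sum>a\<leftarrow>vwalk_arcs P. ?w a) = sum ?w (S \<union> prod.swap ` S)"
    using fin by (simp add: sum.union_disjoint)
  also have "\<dots> \<le> sum ?w {(u, v) \<in> parcs G. {u, v} \<in> path_edges P}"
  proof (rule sum_mono2)
    show "finite {(u, v) \<in> parcs G. {u, v} \<in> path_edges P}"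
      by (rule finite_subset[OF _ pair_finite_arcs]) auto
    have "prod.swap ` S \<subseteq> parcs G"
      using P(2) pair_sym_arcs by (auto simp: symmetric_def dest: symD)
    then show "S \<union> prod.swap ` S \<subseteq> {(u, v) \<in> parcs G. {u, v} \<in> path_edges P}"
      using P(2) unfolding path_edges_def undirected_def S_def by (fastforce simp: insert_commute)
  qed auto
  finally show ?thesis .
qed

section \<open>Dirichlet eigenvalues and the Rayleigh quotient\<close>

context graph_with_boundary
begin

abbreviation "\<Omega> \<equiv> interior_verts G B"

lemma interior_subset: "\<Omega> \<subseteq> pverts G"
  by (auto simp: interior_verts_def)

lemma finite_interior: "finite \<Omega>"
  using interior_subset pair_finite_verts by (rule finite_subset)

lemma sum_verts_eq_interior:
  assumes "\<And>x. x \<in> B \<Longrightarrow> g x = 0"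
  shows "sum g (pverts G) = sum g \<Omega>"
  using assms by (intro sum.mono_neutral_right) (auto simp: interior_verts_def pair_finite_verts)

text \<open>Green's formula with both arguments equal to the eigenfunction: every eigenvalue is a
  Rayleigh quotient.\<close>

lemma dirichlet_eigenvalueD:
  assumes "dirichlet_eigenvalue G B \<mu>"
  obtains f where "\<And>x. x \<in> B \<Longrightarrow> f x = 0" "(\<Sum>x\<in>\<Omega>. (f x)\<^sup>2) > 0"
    "arc_energy (parcs G) f f = 2 * \<mu> * (\<Sum>x\<in>\<Omega>. (f x)\<^sup>2)"
proof -
  obtain f x where f: "x \<in> pverts G" "f x \<noteq> 0" "\<And>x. x \<in> B \<Longrightarrow> f x = 0"
    "\<And>x. x \<in> \<Omega> \<Longrightarrow> graph_laplacian G f x = \<mu> * f x"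
    using assms unfolding dirichlet_eigenvalue_def by blast
  have "x \<in> \<Omega>" using f by (auto simp: interior_verts_def)
  then have "(\<Sum>x\<in>\<Omega>. (f x)\<^sup>2) > 0"
    using f(2) by (intro sum_pos2[OF finite_interior]) auto
  moreover have "arc_energy (parcs G) f f = 2 * (\<Sum>x\<in>\<Omega>. f x * graph_laplacian G f x)"
    by (simp add: arc_energy_green sum_verts_eq_interior f(3))
  then have "arc_energy (parcs G) f f = 2 * \<mu> * (\<Sum>x\<in>\<Omega>. (f x)\<^sup>2)"
    by (simp add: f(4) sum_distrib_left power2_eq_square algebra_simps)
  ultimately show thesis using that f(3) by blast
qed

text \<open>The continuous energy attains its minimum on a compact unit sphere, and quadratic
  scaling carries the bound to every \<open>g\<close> vanishing on \<open>B\<close>.\<close>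

lemma rayleigh_minimum:
  obtains f \<mu> where "\<And>x. x \<notin> \<Omega> \<Longrightarrow> f x = 0" "(\<Sum>x\<in>\<Omega>. (f x)\<^sup>2) = 1"
    "arc_energy (parcs G) f f = 2 * \<mu>"
    "\<And>g. (\<And>x. x \<in> B \<Longrightarrow> g x = 0) \<Longrightarrow> 2 * \<mu> * (\<Sum>x\<in>\<Omega>. (g x)\<^sup>2) \<le> arc_energy (parcs G) g g"
proof -
  \<comment> \<open>The vertex type may be infinite, so coordinates outside \<open>\<Omega>\<close>
    are pinned to 0 and compactness comes from Tychonoff's theorem. The bound 1 on
    \<open>\<Omega>\<close> is implied by the unit norm.\<close>
  define box where "box = Pi\<^sub>E UNIV (\<lambda>x. if x \<in> \<Omega> then {-1..1} else {0::real})"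
  define sphere where "sphere = {f. (\<Sum>x\<in>\<Omega>. (f x)\<^sup>2) = (1::real)}"
  have "compactin (product_topology (\<lambda>i. euclidean) UNIV) box"
    unfolding box_def compactin_PiE by auto
  then have "compact box" by (simp add: euclidean_product_topology)
  moreover have "closed sphere"
    unfolding sphere_def by (intro closed_Collect_eq continuous_intros) auto
  ultimately have "compact (box \<inter> sphere)" by (rule compact_Int_closed)
  moreover obtain x0 where x0: "x0 \<in> \<Omega>" using interior_nonempty by blast
  then have "(\<lambda>x. if x = x0 then 1 else 0) \<in> box \<inter> sphere"
    by (auto simp: box_def sphere_def if_distrib[of "\<lambda>x. x\<^sup>2"] finite_interior cong: if_cong)
  then have "box \<inter> sphere \<noteq> {}" by blast
  moreover have "continuous_on (box \<inter> sphere) (\<lambda>f. arc_energy (parcs G) f f)"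
    unfolding arc_energy_def case_prod_unfold
    by (intro continuous_intros continuous_on_subset[OF continuous_on_product_coordinates]) auto
  ultimately obtain f where f: "f \<in> box \<inter> sphere"
    "\<And>g. g \<in> box \<inter> sphere \<Longrightarrow> arc_energy (parcs G) f f \<le> arc_energy (parcs G) g g"
    using continuous_attains_inf[of "box \<inter> sphere" "\<lambda>f. arc_energy (parcs G) f f"] by blast
  \<comment> \<open>Halved because the arc energy counts each edge twice.\<close>
  define \<mu> where "\<mu> = arc_energy (parcs G) f f / 2"
  have "2 * \<mu> * (\<Sum>x\<in>\<Omega>. (g x)\<^sup>2) \<le> arc_energy (parcs G) g g"
    if g: "\<And>x. x \<in> B \<Longrightarrow> g x = 0" for g
  proof (cases "(\<Sum>x\<in>\<Omega>. (g x)\<^sup>2) = 0")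
    case True
    then show ?thesis by (simp add: arc_energy_def sum_nonneg case_prod_unfold)
  next
    case False
    define s where "s = (\<Sum>x\<in>\<Omega>. (g x)\<^sup>2)"
    \<comment> \<open>The cutoff puts \<open>h\<close> into \<open>box\<close> without changing the
      energy: arcs only meet vertices of the graph, and \<open>g\<close> is 0 on
      \<open>B\<close>.\<close>
    define h where "h x = (if x \<in> \<Omega> then g x / sqrt s else 0)" for x
    have s: "s > 0" using False by (simp add: s_def less_le sum_nonneg)
    have h1: "(\<Sum>x\<in>\<Omega>. (h x)\<^sup>2) = 1"
      using s by (simp add: h_def power_divide sum_divide_distrib[symmetric] s_def[symmetric])
    have "(h x)\<^sup>2 \<le> 1" if "x \<in> \<Omega>" for x
      using member_le_sum[OF that, of "\<lambda>x. (h x)\<^sup>2"] h1 finite_interior by simp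
    then have "h x \<in> {-1..1}" if "x \<in> \<Omega>" for x
      using that abs_square_le_1[of "h x"] by (auto simp: abs_le_iff)
    then have "h \<in> box \<inter> sphere"
      using h1 by (auto simp: box_def sphere_def h_def)
    then have "2 * \<mu> \<le> arc_energy (parcs G) h h"
      using f(2) by (simp add: \<mu>_def)
    also have "arc_energy (parcs G) h h =
        arc_energy (parcs G) (\<lambda>x. (1 / sqrt s) * g x) (\<lambda>x. (1 / sqrt s) * g x)"
      unfolding arc_energy_def
      by (intro sum.cong) (auto simp: h_def interior_verts_def g dest: in_arcsD1 in_arcsD2)
    also have "\<dots> = arc_energy (parcs G) g g / s"
      using s by (simp only: arc_energy_scale) (simp add: power_divide)
    finally show ?thesis using s by (simp add: s_def[symmetric] field_simps)
  qed
  moreover have "f x = 0" if "x \<notin> \<Omega>" for x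
  proof -
    have "f x \<in> (if x \<in> \<Omega> then {-1..1} else {0})"
      using f(1) unfolding box_def by blast
    then show ?thesis using that by simp
  qed
  moreover have "(\<Sum>x\<in>\<Omega>. (f x)\<^sup>2) = 1" using f(1) by (simp add: sphere_def)
  ultimately show thesis using that[of f \<mu>] by (simp add: \<mu>_def)
qed

text \<open>\<open>LEAST\<close> on the reals is informative only if a minimum exists. The Rayleigh
  minimum is an eigenvalue, and no eigenvalue, being a Rayleigh quotient, lies below it.\<close>

lemma dirichlet_eigenvalue_first:
  "dirichlet_eigenvalue G B (first_dirichlet_eigenvalue G B)"
proof -
  obtain f \<mu> where f: "\<And>x. x \<notin> \<Omega> \<Longrightarrow> f x = 0" "(\<Sum>x\<in>\<Omega>. (f x)\<^sup>2) = 1"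
    "arc_energy (parcs G) f f = 2 * \<mu>"
    and min: "\<And>g. (\<And>x. x \<in> B \<Longrightarrow> g x = 0) \<Longrightarrow>
      2 * \<mu> * (\<Sum>x\<in>\<Omega>. (g x)\<^sup>2) \<le> arc_energy (parcs G) g g"
    using rayleigh_minimum by metis
  \<comment> \<open>The first variation of the Rayleigh quotient at its minimiser vanishes in direction of the
    indicator of \<open>x\<close>.\<close>
  have eig: "graph_laplacian G f x = \<mu> * f x" if x: "x \<in> \<Omega>" for x
  proof -
    define d where "d y = (if y = x then 1 else 0 :: real)" for y
    have fd: "(\<Sum>y\<in>\<Omega>. f y * d y) = f x" and dd: "(\<Sum>y\<in>\<Omega>. (d y)\<^sup>2) = 1"
      using x finite_interior by (auto simp: d_def if_distrib[of "\<lambda>z. z\<^sup>2"] if_distrib[of "\<lambda>z. _ * z"] cong: if_cong)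
    have "(\<Sum>y\<in>pverts G. d y * graph_laplacian G f y) = (\<Sum>y\<in>\<Omega>. d y * graph_laplacian G f y)"
      using x by (intro sum_verts_eq_interior) (auto simp: d_def interior_verts_def)
    also have "\<dots> = graph_laplacian G f x"
      using x finite_interior by (simp add: d_def if_distrib[of "\<lambda>z. z * _"] cong: if_cong)
    finally have Efd: "arc_energy (parcs G) f d = 2 * graph_laplacian G f x"
      by (simp add: arc_energy_green)
    \<comment> \<open>Minimality tested on \<open>f + t * d\<close>; the terms constant in
      \<open>t\<close> cancel.\<close>
    have "0 \<le> 4 * (graph_laplacian G f x - \<mu> * f x) * t + (arc_energy (parcs G) d d - 2 * \<mu>) * t\<^sup>2" for t
    proof -
      have "2 * \<mu> * (\<Sum>y\<in>\<Omega>. (f y + t * d y)\<^sup>2) \<le>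
          arc_energy (parcs G) (\<lambda>y. f y + t * d y) (\<lambda>y. f y + t * d y)"
        using x f(1) by (intro min) (auto simp: d_def interior_verts_def)
      moreover have "(\<Sum>y\<in>\<Omega>. (f y + t * d y)\<^sup>2) =
          (\<Sum>y\<in>\<Omega>. (f y)\<^sup>2) + 2 * t * (\<Sum>y\<in>\<Omega>. f y * d y) + t\<^sup>2 * (\<Sum>y\<in>\<Omega>. (d y)\<^sup>2)"
        unfolding sum_distrib_left sum.distrib[symmetric]
        by (intro sum.cong) (auto simp: power2_eq_square algebra_simps)
      ultimately show ?thesis
        by (simp only: arc_energy_perturb fd dd Efd f(2,3)) (simp add: algebra_simps)
    qed
    then have "4 * (graph_laplacian G f x - \<mu> * f x) = 0"
      by (rule linear_coeff_zero_if_quadratic_nonneg)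
    then show ?thesis by simp
  qed
  have "\<exists>x\<in>\<Omega>. f x \<noteq> 0"
    using f(2) by (rule contrapos_pp) simp
  then have "dirichlet_eigenvalue G B \<mu>"
    unfolding dirichlet_eigenvalue_def using eig f(1)
    by (intro exI[of _ f]) (auto simp: interior_verts_def)
  moreover have "\<mu> \<le> \<nu>" if nu: "dirichlet_eigenvalue G B \<nu>" for \<nu>
  proof -
    obtain g where g: "\<And>x. x \<in> B \<Longrightarrow> g x = 0" "(\<Sum>x\<in>\<Omega>. (g x)\<^sup>2) > 0"
      "arc_energy (parcs G) g g = 2 * \<nu> * (\<Sum>x\<in>\<Omega>. (g x)\<^sup>2)"
      using dirichlet_eigenvalueD[OF nu] by metis
    then show ?thesis using min[of g] by simp
  qed
  ultimately show ?thesis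
    unfolding first_dirichlet_eigenvalue_def by (rule LeastI2_order)
qed

section \<open>Summation over the path collection\<close>

text \<open>The constant is 8 instead of 4 because both arcs of each edge enter
  \<open>arc_energy\<close>.\<close>

lemma arc_energy_ge_covering_packing:
  assumes "\<And>x. x \<in> B \<Longrightarrow> f x = 0"
    and paths: "\<forall>P \<in># \<P>. interior_boundary_path G B P"
    and cov: "covering_on_vertices G B c \<P>"
    and pack: "packing_on_edges G p \<P>"
    and len: "\<forall>P \<in># \<P>. vwalk_length P \<le> l"
  shows "8 * real c * (sin (pi / (4 * real l + 2)))\<^sup>2 * (\<Sum>x\<in>\<Omega>. (f x)\<^sup>2) \<le>
    real p * arc_energy (parcs G) f f"
proof -
  define \<kappa> where "\<kappa> = 8 * (sin (pi / (4 * real l + 2)))\<^sup>2"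
  let ?w = "\<lambda>a. (f (fst a) - f (snd a))\<^sup>2"
  have "\<kappa> * (real c * (\<Sum>x\<in>\<Omega>. (f x)\<^sup>2)) \<le>
      \<kappa> * (\<Sum>x\<in>\<Omega>. real (size {#P \<in># \<P>. x \<in> set P#}) * (f x)\<^sup>2)"
    unfolding sum_distrib_left[of "real c"] using cov
    by (intro mult_left_mono sum_mono mult_right_mono)
      (auto simp: covering_on_vertices_def \<kappa>_def)
  also have "\<dots> = (\<Sum>P\<in>#\<P>. \<kappa> * (\<Sum>x\<in>{x \<in> \<Omega>. x \<in> set P}. (f x)\<^sup>2))"
    by (simp add: sum_mset_sum_double_count[OF finite_interior, symmetric] sum_mset_distrib_left)
  also have "\<dots> \<le> (\<Sum>P\<in>#\<P>. \<Sum>a\<in>{a \<in> parcs G. {fst a, snd a} \<in> path_edges P}. ?w a)"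
  proof (rule sum_mset_mono)
    fix P assume "P \<in># \<P>"
    then have P: "vpath P (with_proj G)" "last P \<in> B" "vwalk_length P \<le> l"
      using paths len by (auto simp: interior_boundary_path_def)
    then have ne: "P \<noteq> []" and di: "distinct P" by (auto simp: vpath_def vwalk_def)
    \<comment> \<open>Vertices of \<open>P\<close> outside \<open>\<Omega>\<close> only add
      nonnegative squares.\<close>
    have "(\<Sum>x\<in>{x \<in> \<Omega>. x \<in> set P}. (f x)\<^sup>2) \<le> (\<Sum>x\<in>set P. (f x)\<^sup>2)"
      by (intro sum_mono2) auto
    also have "\<dots> = (\<Sum>x\<leftarrow>P. (f x)\<^sup>2)"
      using di by (simp add: sum_list_distinct_conv_sum_set)
    finally have "\<kappa> * (\<Sum>x\<in>{x \<in> \<Omega>. x \<in> set P}. (f x)\<^sup>2) \<le> \<kappa> * (\<Sum>x\<leftarrow>P. (f x)\<^sup>2)"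
      by (intro mult_left_mono) (auto simp: \<kappa>_def)
    also have "\<dots> \<le> 2 * (\<Sum>(u, v)\<leftarrow>vwalk_arcs P. (f u - f v)\<^sup>2)"
      using vwalk_energy_ge_sin[OF ne, of f l] P assms(1) by (simp add: \<kappa>_def mult_ac)
    also have "\<dots> \<le> (\<Sum>a\<in>{a \<in> parcs G. {fst a, snd a} \<in> path_edges P}. ?w a)"
      using vpath_energy_le[OF P(1), of f] by (simp add: case_prod_unfold)
    finally show "\<kappa> * (\<Sum>x\<in>{x \<in> \<Omega>. x \<in> set P}. (f x)\<^sup>2) \<le>
      (\<Sum>a\<in>{a \<in> parcs G. {fst a, snd a} \<in> path_edges P}. ?w a)" .
  qed
  also have "\<dots> = (\<Sum>a\<in>parcs G. real (size {#P \<in># \<P>. {fst a, snd a} \<in> path_edges P#}) * ?w a)"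
    by (rule sum_mset_sum_double_count[OF pair_finite_arcs])
  also have "\<dots> \<le> (\<Sum>a\<in>parcs G. real p * ?w a)"
  proof (intro sum_mono mult_right_mono)
    fix a assume "a \<in> parcs G"
    then have "{fst a, snd a} \<in> edges G"
      unfolding edges_def undirected_def by (force simp: case_prod_unfold)
    then show "real (size {#P \<in># \<P>. {fst a, snd a} \<in> path_edges P#}) \<le> real p"
      using pack by (simp add: packing_on_edges_def)
  qed auto
  also have "\<dots> = real p * arc_energy (parcs G) f f"
    by (simp add: arc_energy_def sum_distrib_left case_prod_unfold power2_eq_square)
  finally show ?thesis by (simp add: \<kappa>_def algebra_simps)
qed

end

theorem theorem2p7:
  fixes G :: "'a pair_pre_digraph" and B :: "'a set"
    and \<P> :: "'a vwalk multiset" and c p l :: nat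
  assumes "graph_with_boundary G B"
    and "c \<ge> 1" and "p \<ge> 1" and "l \<ge> 1"
    and "\<forall>P \<in># \<P>. interior_boundary_path G B P"
    and "covering_on_vertices G B c \<P>"
    and "packing_on_edges G p \<P>"
    and "\<forall>P \<in># \<P>. vwalk_length P \<le> l"
  shows "first_dirichlet_eigenvalue G B \<ge> 4 * real c / real p * (sin (pi / (4 * real l + 2)))\<^sup>2
    \<and> 4 * real c / real p * (sin (pi / (4 * real l + 2)))\<^sup>2 \<ge> real c / (real p * (real l)\<^sup>2)"
proof
  interpret graph_with_boundary G B by fact
  let ?s = "sin (pi / (4 * real l + 2))"
  obtain f where f: "\<And>x. x \<in> B \<Longrightarrow> f x = 0" "(\<Sum>x\<in>\<Omega>. (f x)\<^sup>2) > 0"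
    "arc_energy (parcs G) f f = 2 * first_dirichlet_eigenvalue G B * (\<Sum>x\<in>\<Omega>. (f x)\<^sup>2)"
    using dirichlet_eigenvalueD[OF dirichlet_eigenvalue_first] by metis
  \<comment> \<open>Evaluated at an eigenfunction for the first eigenvalue, whose positive norm then
    cancels.\<close>
  have "(8 * real c * ?s\<^sup>2) * (\<Sum>x\<in>\<Omega>. (f x)\<^sup>2) \<le>
      (2 * real p * first_dirichlet_eigenvalue G B) * (\<Sum>x\<in>\<Omega>. (f x)\<^sup>2)"
    using arc_energy_ge_covering_packing[of f, OF f(1) assms(5-8)] by (simp add: f(3) algebra_simps)
  then have "8 * real c * ?s\<^sup>2 \<le> 2 * real p * first_dirichlet_eigenvalue G B"
    using f(2) by (rule mult_right_le_imp_le)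
  then show "first_dirichlet_eigenvalue G B \<ge> 4 * real c / real p * ?s\<^sup>2"
    using \<open>p \<ge> 1\<close> by (simp add: field_simps)
  have "1 \<le> (2 * real l * ?s)\<^sup>2"
    using one_le_two_mult_sin[OF \<open>l \<ge> 1\<close>] by simp
  then have "real c * 1 \<le> real c * (2 * real l * ?s)\<^sup>2"
    by (intro mult_left_mono) auto
  then show "4 * real c / real p * ?s\<^sup>2 \<ge> real c / (real p * (real l)\<^sup>2)"
    using \<open>p \<ge> 1\<close> \<open>l \<ge> 1\<close> by (simp add: field_simps)
qed

end
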